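(* For every $a\in\mathbb C$, the escaping set $I(f_a)=\{z\in\mathbb C: f_a^n(z)\to\infty \text{ as } n\to\infty\}$ of the function $f_a(z)=e^z+a$ is not a $G_{\delta\sigma}$-subset of $\mathbb C$; that is, $I(f_a)$ cannot be written as a countable union of $G_\delta$-subsets of $\mathbb C$.
   Context: For $a\in\mathbb C$, $f_a:\mathbb C\to\mathbb C$ is defined by $f_a(z)=e^z+a$, and $f_a^n$ denotes its $n$-fold composition. Convergence $f_a^n(z)\to\infty$ means convergence to the point at infinity on the Riemann sphere, i.e. $|f_a^n(z)|\to\infty$. A $G_\delta$-subset of a space is a countable intersection of open subsets. *)

theory Defs
  imports "HOL-Analysis.Analysis"
begin

definition exp_map :: "complex \<Rightarrow> complex \<Rightarrow> complex"
  where "exp_map a z = exp z + a"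

text \<open>Convergence to the point at infinity of the Riemann sphere is convergence along the
  filter \<^const>\<open>at_infinity\<close>, i.e.\ the norms of the iterates tend to infinity.\<close>

definition escaping_set :: "(complex \<Rightarrow> complex) \<Rightarrow> complex set"
  where "escaping_set f = {z. filterlim (\<lambda>n. (f ^^ n) z) at_infinity sequentially}"

definition gdelta_sigma_in :: "'a topology \<Rightarrow> 'a set \<Rightarrow> bool"
  where "gdelta_sigma_in X = countable union_of gdelta_in X"

end

theory Submission
  imports Defs "HOL-Library.Discrete_Functions" "HOL-Real_Asymp.Real_Asymp"
begin

text \<open>The branches \<open>w \<mapsto> Ln (w - a) + 2\<pi>k\<i>\<close> of the inverse of \<open>f\<^sub>a\<close> contract the half-plane
  \<open>Im w \<ge> Im a + 2\<close> by the factor \<open>1/2\<close> and map it into itself when \<open>k\<close> is large. Hence every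
  sequence \<open>s\<close> of large integers of at most linear growth is the itinerary of a point, which
  depends continuously on \<open>s\<close> and whose \<open>n\<close>-th iterate has imaginary part at least \<open>2\<pi> s n\<close>.
  If each value of a sequence is repeated on a sufficiently long block, then the corresponding
  orbit also stays bounded along blocks with bounded values, so that it escapes iff the sequence
  tends to infinity. Therefore the set of integer sequences tending to infinity is a continuous
  preimage of the escaping set, and a Baire category argument shows that it is not
  \<open>G\<^sub>\<delta>\<^sub>\<sigma>\<close>.\<close>

section \<open>Sequences tending to infinity in Baire space\<close>

text \<open>Basic open sets of the product restrict finitely many coordinates only, so the Baire
  arguments below can secure membership in an open set by fixing a prefix.\<close>

lemma open_sequences_prefix:
  fixes U :: "(nat \<Rightarrow> 'b::topological_space) set"
  assumes "open U" and "x \<in> U"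
  obtains n where "\<And>y. (\<And>i. i < n \<Longrightarrow> y i = x i) \<Longrightarrow> y \<in> U"
proof -
  have "openin (product_topology (\<lambda>i. euclidean) UNIV) U"
    using assms(1) by (simp add: open_fun_def)
  from product_topology_open_contains_basis[OF this assms(2)]
  obtain X where X: "x \<in> (\<Pi>\<^sub>E i\<in>UNIV. X i)" "finite {i. X i \<noteq> UNIV}" "(\<Pi>\<^sub>E i\<in>UNIV. X i) \<subseteq> U"
    by auto
  obtain n where n: "\<And>i. X i \<noteq> UNIV \<Longrightarrow> i < n"
    using X(2) by (auto simp: finite_nat_set_iff_bounded)
  show thesis
  proof (rule that)
    fix y assume y: "\<And>i. i < n \<Longrightarrow> y i = x i"
    have "y i \<in> X i" for i
      using X(1) n[of i] y[of i] by (cases "X i = UNIV") (auto simp: PiE_iff)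
    then show "y \<in> U"
      using X(3) by (auto simp: PiE_iff)
  qed
qed

lemma open_prefix_cylinder:
  fixes x :: "nat \<Rightarrow> 'b::discrete_topology"
  shows "open {y. \<forall>i<n. y i = x i}"
proof -
  have "open (\<Pi>\<^sub>E i\<in>UNIV. if i < n then {x i} else UNIV)"
    by (rule open_PiE) (auto simp: open_discrete intro: finite_subset[of _ "{..<n}"])
  also have "(\<Pi>\<^sub>E i\<in>UNIV. if i < n then {x i} else UNIV) = {y. \<forall>i<n. y i = x i}"
    by (fastforce simp: PiE_iff split: if_split_asm)
  finally show ?thesis .
qed

lemma prefix_limit:
  fixes y :: "nat \<Rightarrow> nat \<Rightarrow> 'b" and n :: "nat \<Rightarrow> nat"
  assumes "strict_mono n" and step: "\<And>j i. i < n j \<Longrightarrow> y (Suc j) i = y j i"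
  obtains z where "\<And>j i. i < n j \<Longrightarrow> z i = y j i"
proof
  have stable: "y k i = y j i" if "j \<le> k" "i < n j" for i j k
    using that(1)
  proof (induction k rule: dec_induct)
    case (step k)
    then show ?case
      using assms(2)[of i k] that(2) strict_mono_leD[OF assms(1) step(1)] by simp
  qed simp
  fix j i assume i: "i < n j"
  \<comment> \<open>The limit is the diagonal \<open>y (Suc i) i\<close>: coordinate
    \<open>i\<close> is settled by stage \<open>Suc i\<close>, as \<open>n\<close> increases
    strictly.\<close>
  have "i < n (Suc i)"
    using strict_mono_imp_increasing[OF assms(1), of "Suc i"] by simp
  then show "y (Suc i) i = y j i"
    using stable[of "Suc i" j i] stable[of j "Suc i" i] i by (cases "j \<le> Suc i") auto
qed

text \<open>This is the Baire category theorem in the closed set of the sequences that extend a given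
  prefix and take values at least \<open>N\<close> afterwards: the sequences taking the value \<open>N\<close> infinitely
  often are comeagre there, so a \<open>G\<^sub>\<delta>\<close> set of sequences tending to infinity cannot be dense.\<close>

lemma prefix_avoiding_G_delta:
  fixes V :: "nat \<Rightarrow> (nat \<Rightarrow> nat) set"
  assumes V: "\<And>j. open (V j)"
    and sub: "(\<Inter>j. V j) \<subseteq> {x. filterlim x at_top sequentially}"
  obtains y n' where "n < n'" and "\<forall>i<n. y i = x i" and "\<forall>i\<ge>n. N \<le> y i"
    and "\<forall>w. (\<forall>i<n'. w i = y i) \<longrightarrow> (\<forall>i\<ge>n'. N \<le> w i) \<longrightarrow> w \<notin> (\<Inter>j. V j)"
proof (rule ccontr)
  assume none: "\<not> thesis"
  note witness = that
  \<comment> \<open>A state \<open>(y, p)\<close> stands for the prefix of \<open>y\<close> of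
    length \<open>p\<close>. \<open>P\<close> keeps \<open>y\<close> in the closed set; a step of
    \<open>Q j\<close> lengthens the prefix, adds one more value \<open>N\<close> and forces
    membership in \<open>V j\<close>.\<close>
  define P where "P = (\<lambda>(y, p). n < p \<and> (\<forall>i<n. y i = x i) \<and> (\<forall>i\<ge>n. N \<le> y i))"
  define Q where "Q = (\<lambda>j (y, p) (y', p'). p < p' \<and> (\<forall>i<p. y' i = y i) \<and>
      (\<exists>r\<ge>p. r < p' \<and> y' r = N) \<and> (\<forall>v. (\<forall>i<p'. v i = y' i) \<longrightarrow> v \<in> V j))"
  \<comment> \<open>A prefix violating this would itself be the pair sought.\<close>
  have dense: "\<exists>w. (\<forall>i<p. w i = y i) \<and> (\<forall>i\<ge>p. N \<le> w i) \<and> w \<in> (\<Inter>j. V j)" if Py: "P (y, p)" for y p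
  proof (rule ccontr)
    assume no: "\<not> ?thesis"
    have thesis
    proof (rule witness)
      show "n < p" "\<forall>i<n. y i = x i" "\<forall>i\<ge>n. N \<le> y i"
        using Py by (simp_all add: P_def)
      show "\<forall>w. (\<forall>i<p. w i = y i) \<longrightarrow> (\<forall>i\<ge>p. N \<le> w i) \<longrightarrow> w \<notin> (\<Inter>j. V j)"
        using no by blast
    qed
    with none show False ..
  qed
  have "\<exists>f. \<forall>j. P (f j) \<and> Q j (f j) (f (Suc j))"
  proof (rule dependent_nat_choice)
    have "P (\<lambda>i. if i < n then x i else N, Suc n)"
      by (auto simp: P_def)
    then show "\<exists>s. P s" ..
  next
    fix s j assume "P s"
    obtain y p where s: "s = (y, p)" by force
    obtain w where w: "\<And>i. i < p \<Longrightarrow> w i = y i" "\<And>i. p \<le> i \<Longrightarrow> N \<le> w i" "w \<in> V j"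
      using dense \<open>P s\<close> s by blast
    obtain q where q: "\<And>v. (\<And>i. i < q \<Longrightarrow> v i = w i) \<Longrightarrow> v \<in> V j"
      using open_sequences_prefix[OF V w(3)] by blast
    \<comment> \<open>Writing \<open>N\<close> at this position disturbs neither the prefix of
      length \<open>p\<close> nor the one of length \<open>q\<close> that forces membership in
      \<open>V j\<close>.\<close>
    define r where "r = max p q"
    define y' where "y' = w(r := N)"
    have "P (y', Suc r)"
      unfolding P_def split
    proof (intro conjI allI impI)
      show "n < Suc r"
        using \<open>P s\<close> by (auto simp: P_def s r_def)
      show "y' i = x i" if "i < n" for i
        using \<open>P s\<close> w(1)[of i] that by (auto simp: P_def s r_def y'_def)
      show "N \<le> y' i" if "n \<le> i" for i
        using \<open>P s\<close> w(1,2)[of i] that by (cases "i < p") (auto simp: P_def s r_def y'_def)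
    qed
    moreover have "Q j (y, p) (y', Suc r)"
      unfolding Q_def split
    proof (intro conjI allI impI)
      show "\<exists>k\<ge>p. k < Suc r \<and> y' k = N"
        by (rule exI[of _ r]) (auto simp: r_def y'_def)
      show "v \<in> V j" if "\<forall>i<Suc r. v i = y' i" for v
        using that by (intro q) (auto simp: r_def y'_def)
    qed (use w(1) in \<open>auto simp: r_def y'_def\<close>)
    ultimately show "\<exists>t. P t \<and> Q j s t"
      unfolding s by blast
  qed
  then obtain f where f: "\<And>j. Q j (f j) (f (Suc j))" by blast
  define y where "y j = fst (f j)" for j
  define p where "p j = snd (f j)" for j
  have Qf: "p j < p (Suc j)" "\<And>i. i < p j \<Longrightarrow> y (Suc j) i = y j i"
      "\<exists>r\<ge>p j. r < p (Suc j) \<and> y (Suc j) r = N"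
      "\<And>v. (\<And>i. i < p (Suc j) \<Longrightarrow> v i = y (Suc j) i) \<Longrightarrow> v \<in> V j" for j
    using f[of j] by (auto simp: Q_def y_def p_def split_beta)
  have p: "strict_mono p"
    using Qf(1) by (simp add: strict_mono_Suc_iff)
  obtain z where z: "\<And>j i. i < p j \<Longrightarrow> z i = y j i"
    using prefix_limit[of p y] p Qf(2) by blast
  \<comment> \<open>The limit lies in every \<open>V j\<close>, hence tends to infinity, yet takes
    the value \<open>N\<close> in every block from \<open>p j\<close> to
    \<open>p (Suc j)\<close>.\<close>
  have "z \<in> (\<Inter>j. V j)"
    using Qf(4) z by blast
  then have "eventually (\<lambda>i. Suc N \<le> z i) sequentially"
    using sub unfolding filterlim_at_top by blast
  then obtain m where m: "\<And>i. m \<le> i \<Longrightarrow> Suc N \<le> z i"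
    by (auto simp: eventually_sequentially)
  obtain r where r: "p m \<le> r" "r < p (Suc m)" "y (Suc m) r = N"
    using Qf(3) by blast
  have "m \<le> r"
    using strict_mono_imp_increasing[OF p, of m] r(1) by simp
  then show False
    using m[of r] z[OF r(2)] r(3) by simp
qed

text \<open>Diagonalisation: stage \<open>m\<close> picks a prefix that avoids the
  \<open>m\<close>-th G_delta set as long as all later values are at least \<open>m\<close>. Later
  stages respect this bound, so the limit tends to infinity and lies in none of the sets.\<close>

lemma sequences_at_top_neq_Union_Inter_open:
  fixes U :: "nat \<Rightarrow> nat \<Rightarrow> (nat \<Rightarrow> nat) set"
  assumes U: "\<And>m j. open (U m j)"
  shows "{x. filterlim x at_top sequentially} \<noteq> (\<Union>m. \<Inter>j. U m j)"
proof
  assume eq: "{x. filterlim x at_top sequentially} = (\<Union>m. \<Inter>j. U m j)"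
  define Q where "Q = (\<lambda>m (y, p) (y', p'). p < p' \<and> (\<forall>i<p. y' i = y i) \<and> (\<forall>i\<ge>p. m \<le> y' i) \<and>
      (\<forall>w. (\<forall>i<p'. w i = y' i) \<longrightarrow> (\<forall>i\<ge>p'. m \<le> w i) \<longrightarrow> w \<notin> (\<Inter>j. U m j)))"
  have "\<exists>f. \<forall>m. True \<and> Q m (f m) (f (Suc m))"
  proof (rule dependent_nat_choice)
    fix s :: "(nat \<Rightarrow> nat) \<times> nat" and m
    obtain y p where s: "s = (y, p)" by force
    have sub: "(\<Inter>j. U m j) \<subseteq> {x. filterlim x at_top sequentially}"
      unfolding eq by (rule UN_upper) simp
    obtain y' p' where y': "p < p'" "\<forall>i<p. y' i = y i" "\<forall>i\<ge>p. m \<le> y' i"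
      "\<forall>w. (\<forall>i<p'. w i = y' i) \<longrightarrow> (\<forall>i\<ge>p'. m \<le> w i) \<longrightarrow> w \<notin> (\<Inter>j. U m j)"
      by (rule prefix_avoiding_G_delta[where V = "U m" and n = p and x = y and N = m, OF U sub])
    have "Q m s (y', p')"
      unfolding Q_def s split using y' by (intro conjI)
    then show "\<exists>t. True \<and> Q m s t" by (intro exI conjI TrueI)
  qed simp
  then obtain f where f: "\<And>m. Q m (f m) (f (Suc m))" by blast
  define y where "y m = fst (f m)" for m
  define p where "p m = snd (f m)" for m
  have Qf: "p m < p (Suc m)" "\<And>i. i < p m \<Longrightarrow> y (Suc m) i = y m i"
      "\<And>i. p m \<le> i \<Longrightarrow> m \<le> y (Suc m) i"
      "\<And>w. \<forall>i<p (Suc m). w i = y (Suc m) i \<Longrightarrow> \<forall>i\<ge>p (Suc m). m \<le> w i \<Longrightarrow> w \<notin> (\<Inter>j. U m j)" for m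
    using f[of m] unfolding Q_def y_def p_def split_beta by simp_all
  have p: "strict_mono p"
    using Qf(1) by (simp add: strict_mono_Suc_iff)
  obtain z where z: "\<And>m i. i < p m \<Longrightarrow> z i = y m i"
    using prefix_limit[of p y] p Qf(2) by blast
  have ge: "m \<le> z i" if "p m \<le> i" for m i
  proof -
    have "i < p (Suc i)"
      using strict_mono_imp_increasing[OF p, of "Suc i"] by simp
    \<comment> \<open>The block \<open>p k \<le> i < p (Suc k)\<close> containing \<open>i\<close>
      was filled at stage \<open>k\<close> with values at least \<open>k\<close>.\<close>
    define k where "k = (LEAST k. i < p (Suc k))"
    have k: "i < p (Suc k)"
      unfolding k_def using \<open>i < p (Suc i)\<close> by (rule LeastI)
    have "m \<le> k"
    proof (rule ccontr)
      assume "\<not> m \<le> k"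
      then have "p (Suc k) \<le> p m"
        using strict_mono_leD[OF p, of "Suc k" m] by simp
      with k that show False by simp
    qed
    moreover have "p k \<le> i"
    proof (cases k)
      case 0
      then show ?thesis
        using that \<open>m \<le> k\<close> by simp
    next
      case (Suc l)
      then have "\<not> i < p (Suc l)"
        unfolding k_def by (intro not_less_Least) simp
      then show ?thesis
        using Suc by simp
    qed
    moreover note k
    ultimately show ?thesis
      using Qf(3)[of k i] z[of i "Suc k"] by simp
  qed
  have "filterlim z at_top sequentially"
    unfolding filterlim_at_top eventually_sequentially using ge by blast
  then have "z \<in> (\<Union>m. \<Inter>j. U m j)"
    unfolding eq[symmetric] by simp
  then obtain m where "z \<in> (\<Inter>j. U m j)"
    by (rule UN_E)
  moreover have "z \<notin> (\<Inter>j. U m j)"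
  proof (rule Qf(4))
    show "\<forall>i\<ge>p (Suc m). m \<le> z i"
      using ge[of "Suc m"] by (auto intro: Suc_leD)
  qed (simp add: z)
  ultimately show False by contradiction
qed

section \<open>Indexed form of G_delta_sigma sets\<close>

lemma gdelta_sigma_in_euclideanE:
  fixes S :: "'a::topological_space set"
  assumes "gdelta_sigma_in euclidean S"
  obtains U :: "nat \<Rightarrow> nat \<Rightarrow> 'a set" where "\<And>m j. open (U m j)" and "S = (\<Union>m. \<Inter>j. U m j)"
proof -
  obtain \<G> where \<G>: "countable \<G>" "\<And>G. G \<in> \<G> \<Longrightarrow> gdelta_in euclidean G" "S = \<Union>\<G>"
    using assms unfolding gdelta_sigma_in_def union_of_def by auto
  \<comment> \<open>Inserting the empty set makes the family nonempty, hence enumerable, without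
    changing its union.\<close>
  define G where "G = from_nat_into (insert {} \<G>)"
  have range_G: "range G = insert {} \<G>"
    unfolding G_def using \<G>(1) by (intro range_from_nat_into) auto
  have "gdelta_in euclidean ({} :: 'a set)"
    unfolding gdelta_in_descending by (intro exI[of _ "\<lambda>_. {}"]) auto
  then have "gdelta_in euclidean (G m)" for m
    using \<G>(2) range_G rangeI[of G m] by auto
  then have "\<forall>m. \<exists>C. (\<forall>j. open (C j)) \<and> (\<forall>j. C (Suc j) \<subseteq> C j) \<and> \<Inter>(range C) = G m"
    by (simp add: gdelta_in_descending)
  from choice[OF this] obtain U
    where U: "\<forall>m. (\<forall>j. open (U m j)) \<and> (\<forall>j. U m (Suc j) \<subseteq> U m j) \<and> \<Inter>(range (U m)) = G m" ..
  show thesis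
  proof (rule that)
    have "S = \<Union>(range G)"
      using \<G>(3) range_G by simp
    then show "S = (\<Union>m. \<Inter>j. U m j)"
      by (simp add: U)
  qed (simp add: U)
qed

section \<open>Points with prescribed itinerary\<close>

text \<open>Height 2 above \<open>a\<close> keeps \<open>w - a\<close> off the cut of
  \<open>Ln\<close> and gives the derivative \<open>1 / (w - a)\<close> of every inverse branch norm
  at most 1/2.\<close>

definition upper_half :: "complex \<Rightarrow> complex set"
  where "upper_half a = {w. Im a + 2 \<le> Im w}"

definition exp_branch :: "complex \<Rightarrow> nat \<Rightarrow> complex \<Rightarrow> complex"
  where "exp_branch a k w = Ln (w - a) + complex_of_real (2 * pi * real k) * \<i>"

lemma exp_map_exp_branch:
  assumes "w \<noteq> a"
  shows "exp_map a (exp_branch a k w) = w"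
  using assms exp_integer_2pi[of "real k"]
  by (simp add: exp_map_def exp_branch_def exp_add mult_ac)

lemma Im_exp_branch_ge:
  assumes "w \<in> upper_half a"
  shows "2 * pi * real k \<le> Im (exp_branch a k w)"
  using assms Im_Ln_pos_lt_imp[of "w - a"] by (simp add: upper_half_def exp_branch_def)

lemma exp_branch_in_upper_half:
  assumes "w \<in> upper_half a" and "Im a + 2 \<le> 2 * pi * real k"
  shows "exp_branch a k w \<in> upper_half a"
  using assms Im_exp_branch_ge[of w a k] by (simp add: upper_half_def)

lemma convex_upper_half: "convex (upper_half a)"
  unfolding upper_half_def by (simp add: convex_halfspace_Im_ge)

lemma closed_upper_half: "closed (upper_half a)"
  unfolding upper_half_def by (simp add: closed_halfspace_Im_ge)

lemma dist_exp_branch_le: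
  assumes "v \<in> upper_half a" and "w \<in> upper_half a"
  shows "dist (exp_branch a k v) (exp_branch a k w) \<le> dist v w / 2"
proof -
  have "norm (exp_branch a k v - exp_branch a k w) \<le> 1/2 * norm (v - w)"
  proof (rule field_differentiable_bound[OF convex_upper_half _ _ assms])
    fix z assume z: "z \<in> upper_half a"
    then have im: "2 \<le> Im (z - a)" by (simp add: upper_half_def)
    then have "z - a \<notin> \<real>\<^sub>\<le>\<^sub>0"
      by (auto simp: complex_nonpos_Reals_iff)
    then show "(exp_branch a k has_field_derivative inverse (z - a)) (at z within upper_half a)"
      unfolding exp_branch_def by (auto intro!: derivative_eq_intros)
    have "2 \<le> norm (z - a)"
      using im abs_Im_le_cmod[of "z - a"] by linarith
    then show "norm (inverse (z - a)) \<le> 1/2"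
      using le_imp_inverse_le[of 2 "norm (z - a)"] by (simp add: norm_inverse)
  qed
  then show ?thesis by (simp add: dist_norm)
qed

section \<open>Compositions of inverse branches along an itinerary\<close>

primrec pullback :: "complex \<Rightarrow> nat \<Rightarrow> (nat \<Rightarrow> nat) \<Rightarrow> complex \<Rightarrow> complex" where
  "pullback a 0 s w = w"
| "pullback a (Suc n) s w = exp_branch a (s 0) (pullback a n (\<lambda>i. s (Suc i)) w)"

text \<open>The choice of the base point \<open>a + 2\<i>\<close> in \<open>upper_half a\<close> is immaterial.\<close>

definition itinerary_point :: "complex \<Rightarrow> (nat \<Rightarrow> nat) \<Rightarrow> complex"
  where "itinerary_point a s = lim (\<lambda>n. pullback a n s (a + 2 * \<i>))"

text \<open>The first condition makes each branch map \<open>upper_half a\<close> into itself. The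
  second allows growth that the contraction by \<open>2 ^ n\<close> still beats, and it survives a
  shift by \<open>n\<close> with \<open>B + n\<close> for \<open>B\<close>.\<close>

definition itinerary :: "complex \<Rightarrow> (nat \<Rightarrow> nat) \<Rightarrow> bool"
  where "itinerary a s \<longleftrightarrow> (\<forall>n. Im a + 2 \<le> 2 * pi * real (s n)) \<and> (\<exists>B. \<forall>n. s n \<le> B + n)"

text \<open>With \<open>r B\<close> the radius, the induction that bounds the pullbacks needs
  \<open>r (B + 1) / 2 + 2\<pi>B + \<bar>Ln (2\<i>) - (a + 2\<i>)\<bar> \<le> r B\<close>; this is the affine solution.\<close>

definition itinerary_radius :: "complex \<Rightarrow> nat \<Rightarrow> real"
  where "itinerary_radius a B = 4 * pi * (real B + 1) + 2 * norm (Ln (2 * \<i>) - (a + 2 * \<i>))"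

lemma base_in_upper_half: "a + 2 * \<i> \<in> upper_half a"
  by (simp add: upper_half_def)

lemma itinerary_shift:
  assumes "itinerary a s"
  shows "itinerary a (\<lambda>i. s (i + n))"
proof -
  obtain B where "\<And>n. s n \<le> B + n"
    using assms by (auto simp: itinerary_def)
  then have "s (i + n) \<le> (B + n) + i" for i
    by (metis add.assoc add.commute)
  then show ?thesis
    using assms unfolding itinerary_def by blast
qed

lemma pullback_in_upper_half:
  assumes "\<And>n. Im a + 2 \<le> 2 * pi * real (s n)" and "w \<in> upper_half a"
  shows "pullback a n s w \<in> upper_half a"
  using assms by (induction n arbitrary: s) (auto intro!: exp_branch_in_upper_half)

lemma pullback_add:
  "pullback a (n + m) s w = pullback a n s (pullback a m (\<lambda>i. s (i + n)) w)"
  by (induction n arbitrary: s) auto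

lemma pullback_cong:
  assumes "\<And>i. i < n \<Longrightarrow> s i = t i"
  shows "pullback a n s w = pullback a n t w"
  using assms
proof (induction n arbitrary: s t)
  case (Suc n)
  have "pullback a n (\<lambda>i. s (Suc i)) w = pullback a n (\<lambda>i. t (Suc i)) w"
    by (rule Suc.IH) (simp add: Suc.prems)
  then show ?case
    using Suc.prems[of 0] by simp
qed simp

lemma dist_pullback_le:
  assumes "\<And>n. Im a + 2 \<le> 2 * pi * real (s n)" and "v \<in> upper_half a" and "w \<in> upper_half a"
  shows "dist (pullback a n s v) (pullback a n s w) \<le> dist v w / 2 ^ n"
  using assms(1)
proof (induction n arbitrary: s)
  case (Suc n)
  define t where "t = (\<lambda>i. s (Suc i))"
  have "dist (pullback a (Suc n) s v) (pullback a (Suc n) s w)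
      \<le> dist (pullback a n t v) (pullback a n t w) / 2"
    unfolding pullback.simps t_def
    by (intro dist_exp_branch_le pullback_in_upper_half assms Suc.prems)
  also have "\<dots> \<le> (dist v w / 2 ^ n) / 2"
    using Suc.IH[of t] Suc.prems by (simp add: t_def)
  finally show ?case by (simp add: mult.commute)
qed simp

text \<open>Dropping the first entry of \<open>s\<close> raises the bound \<open>B\<close> by one,
  so the induction must cover all \<open>B\<close>; the halving by the outermost branch absorbs the
  increase.\<close>

lemma dist_pullback_base_le:
  assumes "\<And>n. Im a + 2 \<le> 2 * pi * real (s n)" and "\<And>n. s n \<le> B + n"
  shows "dist (pullback a n s (a + 2 * \<i>)) (a + 2 * \<i>) \<le> itinerary_radius a B"
  using assms
proof (induction n arbitrary: s B)
  case 0
  then show ?case by (simp add: itinerary_radius_def)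
next
  case (Suc n)
  define t where "t = (\<lambda>i. s (Suc i))"
  define b where "b = a + 2 * \<i>"
  have t: "Im a + 2 \<le> 2 * pi * real (t i)" "t i \<le> Suc B + i" for i
    using Suc.prems(1)[of "Suc i"] Suc.prems(2)[of "Suc i"] by (simp_all add: t_def)
  \<comment> \<open>Split at the image of the base point: the first term is halved by contraction,
    the second is estimated using \<open>b - a = 2 * \<i>\<close>.\<close>
  have "dist (pullback a (Suc n) s b) b
      \<le> dist (exp_branch a (s 0) (pullback a n t b)) (exp_branch a (s 0) b)
        + dist (exp_branch a (s 0) b) b"
    unfolding pullback.simps t_def by (rule dist_triangle)
  also have "\<dots> \<le> itinerary_radius a (Suc B) / 2 + dist (exp_branch a (s 0) b) b"
    using dist_exp_branch_le[of "pullback a n t b" a b "s 0"] Suc.IH[of t "Suc B"] t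
      pullback_in_upper_half[of a t b n] base_in_upper_half[of a]
    by (simp add: b_def)
  also have "dist (exp_branch a (s 0) b) b
      \<le> norm (Ln (2 * \<i>) - (a + 2 * \<i>)) + norm (complex_of_real (2 * pi * real (s 0)) * \<i>)"
    unfolding dist_norm exp_branch_def b_def
    by (rule order_trans[OF _ norm_triangle_ineq]) (simp add: algebra_simps)
  also have "norm (complex_of_real (2 * pi * real (s 0)) * \<i>) = 2 * pi * real (s 0)"
    by (simp add: norm_mult)
  also have "2 * pi * real (s 0) \<le> 2 * pi * real B"
    using Suc.prems(2)[of 0] by simp
  finally show ?case
    by (simp add: b_def itinerary_radius_def field_simps)
qed

lemma itinerary_radius_over_power_tendsto_0:
  "(\<lambda>n. itinerary_radius a (B + n) / 2 ^ n) \<longlonglongrightarrow> 0"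
  unfolding itinerary_radius_def by real_asymp

lemma convergent_pullback:
  assumes "itinerary a s"
  shows "convergent (\<lambda>n. pullback a n s (a + 2 * \<i>))"
proof -
  obtain B where B: "\<And>n. s n \<le> B + n" and K: "\<And>n. Im a + 2 \<le> 2 * pi * real (s n)"
    using assms by (auto simp: itinerary_def)
  define b where "b = a + 2 * \<i>"
  \<comment> \<open>Both points arise by the same \<open>n\<close> branches, from the base point and
    from its pullback along the shifted itinerary, whose growth bound is
    \<open>B + n\<close>.\<close>
  have close: "dist (pullback a (n + m) s b) (pullback a n s b) \<le> itinerary_radius a (B + n) / 2 ^ n" for n m
  proof -
    define t where "t = (\<lambda>i. s (i + n))"
    have t: "Im a + 2 \<le> 2 * pi * real (t i)" "t i \<le> (B + n) + i" for i
      using K[of "i + n"] B[of "i + n"] by (simp_all add: t_def)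
    have "dist (pullback a (n + m) s b) (pullback a n s b) \<le> dist (pullback a m t b) b / 2 ^ n"
      unfolding pullback_add t_def[symmetric] b_def
      by (intro dist_pullback_le pullback_in_upper_half base_in_upper_half K t)
    also have "\<dots> \<le> itinerary_radius a (B + n) / 2 ^ n"
      unfolding b_def by (intro divide_right_mono dist_pullback_base_le t) auto
    finally show ?thesis .
  qed
  have "Cauchy (\<lambda>n. pullback a n s b)"
  proof (rule metric_CauchyI)
    fix e :: real assume "0 < e"
    then have "eventually (\<lambda>n. itinerary_radius a (B + n) / 2 ^ n < e / 2) sequentially"
      by (intro order_tendstoD(2)[OF itinerary_radius_over_power_tendsto_0]) simp
    then obtain M where M: "itinerary_radius a (B + M) / 2 ^ M < e / 2"
      by (auto simp: eventually_sequentially)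
    have "dist (pullback a n s b) (pullback a M s b) < e / 2" if "M \<le> n" for n
      using close[of M "n - M"] that by (intro le_less_trans[OF _ M]) simp
    then show "\<exists>M. \<forall>m\<ge>M. \<forall>n\<ge>M. dist (pullback a m s b) (pullback a n s b) < e"
      by (metis dist_triangle_half_l dist_commute)
  qed
  then show ?thesis
    unfolding b_def by (rule Cauchy_convergent)
qed

section \<open>Dynamics of the limit points\<close>

lemma pullback_tendsto_itinerary_point:
  assumes "itinerary a s"
  shows "(\<lambda>n. pullback a n s (a + 2 * \<i>)) \<longlonglongrightarrow> itinerary_point a s"
  using convergent_pullback[OF assms] by (simp add: itinerary_point_def convergent_LIMSEQ_iff)

lemma itinerary_point_in_upper_half:
  assumes "itinerary a s"
  shows "itinerary_point a s \<in> upper_half a"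
  using closed_upper_half _ pullback_tendsto_itinerary_point[OF assms]
proof (rule closed_sequentially)
  show "pullback a n s (a + 2 * \<i>) \<in> upper_half a" for n
    using assms by (intro pullback_in_upper_half base_in_upper_half) (simp add: itinerary_def)
qed

lemma dist_itinerary_point_base_le:
  assumes "itinerary a s" and "\<And>n. s n \<le> B + n"
  shows "dist (itinerary_point a s) (a + 2 * \<i>) \<le> itinerary_radius a B"
proof (rule Lim_bounded)
  show "(\<lambda>n. dist (pullback a n s (a + 2 * \<i>)) (a + 2 * \<i>)) \<longlonglongrightarrow> dist (itinerary_point a s) (a + 2 * \<i>)"
    by (intro tendsto_intros pullback_tendsto_itinerary_point assms)
  show "\<forall>n\<ge>0. dist (pullback a n s (a + 2 * \<i>)) (a + 2 * \<i>) \<le> itinerary_radius a B"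
    using assms by (intro allI impI dist_pullback_base_le) (auto simp: itinerary_def)
qed

text \<open>Pass to the limit in the recursion of \<open>pullback\<close>; the branch is continuous
  at the shifted limit point, which stays in the closed half-plane away from the cut.\<close>

lemma itinerary_point_eq_exp_branch:
  assumes "itinerary a s"
  shows "itinerary_point a s = exp_branch a (s 0) (itinerary_point a (\<lambda>i. s (Suc i)))"
proof -
  define t where "t = (\<lambda>i. s (Suc i))"
  have t: "itinerary a t"
    using itinerary_shift[OF assms, of 1] by (simp add: t_def)
  have "itinerary_point a t \<in> upper_half a"
    by (rule itinerary_point_in_upper_half[OF t])
  then have "itinerary_point a t - a \<notin> \<real>\<^sub>\<le>\<^sub>0"
    by (auto simp: upper_half_def complex_nonpos_Reals_iff)
  then have "(\<lambda>n. exp_branch a (s 0) (pullback a n t (a + 2 * \<i>)))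
      \<longlonglongrightarrow> exp_branch a (s 0) (itinerary_point a t)"
    unfolding exp_branch_def by (intro tendsto_intros pullback_tendsto_itinerary_point[OF t])
  then have "(\<lambda>n. pullback a (Suc n) s (a + 2 * \<i>)) \<longlonglongrightarrow> exp_branch a (s 0) (itinerary_point a t)"
    by (simp add: t_def)
  moreover have "(\<lambda>n. pullback a (Suc n) s (a + 2 * \<i>)) \<longlonglongrightarrow> itinerary_point a s"
    by (rule LIMSEQ_Suc[OF pullback_tendsto_itinerary_point[OF assms]])
  ultimately show ?thesis
    unfolding t_def by (metis LIMSEQ_unique)
qed

lemma itinerary_point_eq_pullback:
  assumes "itinerary a s"
  shows "itinerary_point a s = pullback a n s (itinerary_point a (\<lambda>i. s (i + n)))"
  using assms
proof (induction n arbitrary: s)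
  case (Suc n)
  have "itinerary a (\<lambda>i. s (Suc i))"
    using itinerary_shift[OF Suc.prems, of 1] by simp
  then show ?case
    using Suc.IH[of "\<lambda>i. s (Suc i)"] itinerary_point_eq_exp_branch[OF Suc.prems] by simp
qed simp

lemma exp_map_itinerary_point:
  assumes "itinerary a s"
  shows "exp_map a (itinerary_point a s) = itinerary_point a (\<lambda>i. s (Suc i))"
proof -
  have "itinerary_point a (\<lambda>i. s (Suc i)) \<in> upper_half a"
    using itinerary_shift[OF assms, of 1] by (intro itinerary_point_in_upper_half) simp
  then have "itinerary_point a (\<lambda>i. s (Suc i)) \<noteq> a"
    by (auto simp: upper_half_def)
  then show ?thesis
    by (simp add: itinerary_point_eq_exp_branch[OF assms] exp_map_exp_branch)
qed

lemma funpow_exp_map_itinerary_point: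
  assumes "itinerary a s"
  shows "(exp_map a ^^ n) (itinerary_point a s) = itinerary_point a (\<lambda>i. s (i + n))"
proof (induction n)
  case (Suc n)
  then show ?case
    using exp_map_itinerary_point[OF itinerary_shift[OF assms, of n]] by simp
qed simp

lemma norm_itinerary_point_ge:
  assumes "itinerary a s"
  shows "2 * pi * real (s 0) \<le> norm (itinerary_point a s)"
proof -
  have "itinerary_point a (\<lambda>i. s (Suc i)) \<in> upper_half a"
    using itinerary_shift[OF assms, of 1] by (intro itinerary_point_in_upper_half) simp
  then have "2 * pi * real (s 0) \<le> Im (itinerary_point a s)"
    unfolding itinerary_point_eq_exp_branch[OF assms] by (rule Im_exp_branch_ge)
  then show ?thesis
    using abs_Im_le_cmod[of "itinerary_point a s"] by linarith
qed

text \<open>Both points are images under the same \<open>n\<close> contractions of tail points lying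
  within \<open>itinerary_radius a (B + n)\<close> of the base point.\<close>

lemma dist_itinerary_point_le:
  assumes "itinerary a s" and "itinerary a t" and "\<And>n. s n \<le> B + n" and "\<And>n. t n \<le> B + n"
    and agree: "\<And>i. i < n \<Longrightarrow> s i = t i"
  shows "dist (itinerary_point a s) (itinerary_point a t) \<le> 2 * (itinerary_radius a (B + n) / 2 ^ n)"
proof -
  define u where "u = itinerary_point a (\<lambda>i. s (i + n))"
  define v where "v = itinerary_point a (\<lambda>i. t (i + n))"
  note shift = itinerary_shift[OF assms(1), of n] itinerary_shift[OF assms(2), of n]
  have near: "dist u (a + 2 * \<i>) \<le> itinerary_radius a (B + n)"
    "dist v (a + 2 * \<i>) \<le> itinerary_radius a (B + n)"
    unfolding u_def v_def using assms(3)[of "_ + n"] assms(4)[of "_ + n"]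
    by (auto intro!: dist_itinerary_point_base_le shift simp: add_ac)
  have "dist (itinerary_point a s) (itinerary_point a t) = dist (pullback a n s u) (pullback a n s v)"
    unfolding itinerary_point_eq_pullback[OF assms(1), of n]
      itinerary_point_eq_pullback[OF assms(2), of n] u_def v_def
    using pullback_cong[of n s t, OF agree] by simp
  also have "\<dots> \<le> dist u v / 2 ^ n"
    using assms(1) by (intro dist_pullback_le)
      (auto simp: itinerary_def u_def v_def intro!: itinerary_point_in_upper_half shift)
  also have "dist u v \<le> 2 * itinerary_radius a (B + n)"
    using near dist_triangle2[of u v "a + 2 * \<i>"] by linarith
  finally show ?thesis
    by (simp add: divide_right_mono)
qed

section \<open>Encoding sequences as itineraries\<close>

text \<open>The value \<open>x k\<close>, truncated at \<open>k\<close>, is repeated on the block \<open>k\<^sup>2 \<le> n < (k + 1)\<^sup>2\<close>. The blocks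
  are so long that, seen from the start of block \<open>k\<close>, the itinerary exceeds \<open>K + x k\<close> at most by
  the elapsed time; hence the orbit is then at a distance bounded in terms of \<open>x k\<close> alone.\<close>

definition block_itinerary :: "nat \<Rightarrow> (nat \<Rightarrow> nat) \<Rightarrow> nat \<Rightarrow> nat"
  where "block_itinerary K x n = K + min (x (floor_sqrt n)) (floor_sqrt n)"

lemma block_itinerary_le: "block_itinerary K x n \<le> K + n"
  unfolding block_itinerary_def using floor_sqrt_le[of n] by simp

text \<open>Within block \<open>k\<close> the term \<open>x k\<close> suffices. In a later block
  \<open>j > k\<close> the truncation leaves at most \<open>K + j\<close>, and
  \<open>j \<le> j^2 - k^2 \<le> i\<close>.\<close>

lemma block_itinerary_block_start_le: "block_itinerary K x (i + k\<^sup>2) \<le> K + x k + i"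
proof -
  define j where "j = floor_sqrt (i + k\<^sup>2)"
  have "k \<le> j"
    unfolding j_def by (rule le_floor_sqrtI) simp
  moreover have "j \<le> i" if less: "k < j"
  proof -
    obtain d where d: "j = k + Suc d"
      using less less_iff_Suc_add[of k j] by auto
    have "j\<^sup>2 \<le> i + k\<^sup>2"
      unfolding j_def by (rule floor_sqrt_power2_le)
    then show ?thesis
      unfolding d by (simp add: power2_eq_square algebra_simps)
  qed
  ultimately show ?thesis
    unfolding block_itinerary_def j_def[symmetric] by (cases "k = j") auto
qed

lemma itinerary_block_itinerary:
  assumes "Im a + 2 \<le> 2 * pi * real K"
  shows "itinerary a (block_itinerary K x)"
  unfolding itinerary_def
proof
  show "\<forall>n. Im a + 2 \<le> 2 * pi * real (block_itinerary K x n)"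
    by (intro allI order_trans[OF assms] mult_left_mono) (auto simp: block_itinerary_def)
  show "\<exists>B. \<forall>n. block_itinerary K x n \<le> B + n"
    using block_itinerary_le by blast
qed

text \<open>Truncation bounds all encoded itineraries by \<open>K + n\<close> simultaneously, so a
  common prefix alone makes the points close.\<close>

lemma continuous_itinerary_point_block_itinerary:
  assumes "Im a + 2 \<le> 2 * pi * real K"
  shows "continuous_on UNIV (\<lambda>x. itinerary_point a (block_itinerary K x))"
unfolding continuous_on_def
proof
  define \<Phi> where "\<Phi> = (\<lambda>x. itinerary_point a (block_itinerary K x))"
  fix x
  have "(\<Phi> \<longlongrightarrow> \<Phi> x) (at x)"
  proof (rule tendstoI)
    fix e :: real assume "0 < e"
    have "(\<lambda>n. 2 * (itinerary_radius a (K + n) / 2 ^ n)) \<longlonglongrightarrow> 0"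
      using tendsto_mult_left[OF itinerary_radius_over_power_tendsto_0, of 2] by simp
    then have "eventually (\<lambda>n. 2 * (itinerary_radius a (K + n) / 2 ^ n) < e) sequentially"
      using \<open>0 < e\<close> by (rule order_tendstoD(2))
    then obtain n where n: "2 * (itinerary_radius a (K + n) / 2 ^ n) < e"
      by (auto simp: eventually_sequentially)
    have "dist (\<Phi> y) (\<Phi> x) < e" if "\<forall>i<n. y i = x i" for y
    proof -
      \<comment> \<open>Entry \<open>i\<close> reads the sequence only at
        \<open>floor_sqrt i \<le> i < n\<close>.\<close>
      have "block_itinerary K y i = block_itinerary K x i" if "i < n" for i
        using \<open>\<forall>i<n. y i = x i\<close> le_less_trans[OF floor_sqrt_le that]
        by (simp add: block_itinerary_def)
      then show ?thesis
        unfolding \<Phi>_def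
        by (intro le_less_trans[OF dist_itinerary_point_le n] itinerary_block_itinerary assms
            block_itinerary_le)
    qed
    then show "eventually (\<lambda>y. dist (\<Phi> y) (\<Phi> x) < e) (at x)"
      unfolding eventually_at_topological using open_prefix_cylinder[of n x]
      by (intro exI[of _ "{y. \<forall>i<n. y i = x i}"]) auto
  qed
  then show "((\<lambda>x. itinerary_point a (block_itinerary K x)) \<longlongrightarrow>
      itinerary_point a (block_itinerary K x)) (at x)"
    unfolding \<Phi>_def .
qed

lemma itinerary_point_block_itinerary_escapes_iff:
  assumes "Im a + 2 \<le> 2 * pi * real K"
  shows "itinerary_point a (block_itinerary K x) \<in> escaping_set (exp_map a) \<longleftrightarrow>
    filterlim x at_top sequentially"
proof -
  define s where "s = block_itinerary K x"
  define Z where "Z n = itinerary_point a (\<lambda>i. s (i + n))" for n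
  have s: "itinerary a s"
    unfolding s_def by (rule itinerary_block_itinerary[OF assms])
  have Z: "itinerary_point a s \<in> escaping_set (exp_map a) \<longleftrightarrow>
      filterlim (\<lambda>n. norm (Z n)) at_top sequentially"
    by (simp add: escaping_set_def funpow_exp_map_itinerary_point[OF s] Z_def
        filterlim_at_infinity_conv_norm_at_top)
  show ?thesis
    unfolding s_def[symmetric] Z
  proof
    assume esc: "filterlim (\<lambda>n. norm (Z n)) at_top sequentially"
    \<comment> \<open>Block starts suffice: a value \<open>x k < M\<close> puts the orbit at time
      \<open>k^2\<close> in a disc around the base point whose radius is independent of
      \<open>k\<close>.\<close>
    have "filterlim (\<lambda>k::nat. k\<^sup>2) at_top sequentially"
      by (rule filterlim_at_top_mono[OF filterlim_ident]) (auto simp: power2_nat_le_imp_le power2_eq_square)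
    from filterlim_compose[OF esc this]
    have esc_squares: "filterlim (\<lambda>k. norm (Z (k\<^sup>2))) at_top sequentially" .
    show "filterlim x at_top sequentially"
      unfolding filterlim_at_top
    proof
      fix M
      define R where "R = norm (a + 2 * \<i>) + itinerary_radius a (K + M)"
      have "eventually (\<lambda>k. R + 1 \<le> norm (Z (k\<^sup>2))) sequentially"
        using esc_squares unfolding filterlim_at_top by blast
      then show "eventually (\<lambda>k. M \<le> x k) sequentially"
      proof eventually_elim
        case (elim k)
        show "M \<le> x k"
        proof (rule ccontr)
          assume "\<not> M \<le> x k"
          then have "s (i + k\<^sup>2) \<le> (K + M) + i" for i
            using block_itinerary_block_start_le[of K x i k] by (simp add: s_def)
          then have "dist (Z (k\<^sup>2)) (a + 2 * \<i>) \<le> itinerary_radius a (K + M)"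
            unfolding Z_def by (intro dist_itinerary_point_base_le itinerary_shift s)
          then have "norm (Z (k\<^sup>2)) \<le> R"
            unfolding R_def dist_norm using norm_triangle_sub[of "Z (k\<^sup>2)" "a + 2 * \<i>"] by linarith
          with elim show False by simp
        qed
      qed
    qed
  next
    assume x: "filterlim x at_top sequentially"
    \<comment> \<open>Truncation and repetition on blocks both preserve divergence, and the entries
      bound the norms of the orbit from below.\<close>
    have "filterlim (\<lambda>k. min (x k) k) at_top sequentially"
      using x eventually_ge_at_top by (auto simp: filterlim_at_top eventually_conj_iff)
    moreover have "filterlim floor_sqrt at_top sequentially"
      unfolding filterlim_at_top le_floor_sqrt_iff using eventually_ge_at_top by blast
    ultimately have "filterlim (\<lambda>n. min (x (floor_sqrt n)) (floor_sqrt n)) at_top sequentially"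
      by (rule filterlim_compose)
    from filterlim_compose[OF filterlim_real_sequentially this]
    show "filterlim (\<lambda>n. norm (Z n)) at_top sequentially"
    proof (rule filterlim_at_top_mono, intro always_eventually allI)
      fix n
      have "real (min (x (floor_sqrt n)) (floor_sqrt n)) \<le> 1 * real (s n)"
        by (simp add: s_def block_itinerary_def)
      also have "\<dots> \<le> 2 * pi * real (s n)"
        using pi_gt3 by (intro mult_right_mono) auto
      also have "\<dots> \<le> norm (Z n)"
        using norm_itinerary_point_ge[OF itinerary_shift[OF s, of n]] by (simp add: Z_def)
      finally show "real (min (x (floor_sqrt n)) (floor_sqrt n)) \<le> norm (Z n)" .
    qed
  qed
qed

section \<open>Reduction of the escaping set to sequences\<close>

theorem theorem1:
  fixes a :: complex
  shows "\<not> gdelta_sigma_in euclidean (escaping_set (exp_map a))"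
proof
  assume "gdelta_sigma_in euclidean (escaping_set (exp_map a))"
  then obtain U :: "nat \<Rightarrow> nat \<Rightarrow> complex set"
    where U: "\<And>m j. open (U m j)" "escaping_set (exp_map a) = (\<Union>m. \<Inter>j. U m j)"
    by (rule gdelta_sigma_in_euclideanE) blast
  obtain K :: nat where "Im a + 2 \<le> real K"
    using real_arch_simple by blast
  also have "\<dots> \<le> 2 * pi * real K"
    using pi_gt3 mult_right_mono[of 1 "2 * pi" "real K"] by simp
  finally have K: "Im a + 2 \<le> 2 * pi * real K" .
  define \<Phi> where "\<Phi> = (\<lambda>x. itinerary_point a (block_itinerary K x))"
  \<comment> \<open>By continuity of \<open>\<Phi>\<close>, a representation of the escaping set
    pulls back to one of the set of sequences tending to infinity.\<close>
  have "open (\<Phi> -` U m j)" for m j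
    unfolding \<Phi>_def by (intro open_vimage U continuous_itinerary_point_block_itinerary K)
  then have "{x. filterlim x at_top sequentially} \<noteq> (\<Union>m. \<Inter>j. \<Phi> -` U m j)"
    by (rule sequences_at_top_neq_Union_Inter_open)
  moreover have "{x. filterlim x at_top sequentially} = \<Phi> -` escaping_set (exp_map a)"
    using itinerary_point_block_itinerary_escapes_iff[OF K] by (auto simp: \<Phi>_def)
  moreover have "\<Phi> -` escaping_set (exp_map a) = (\<Union>m. \<Inter>j. \<Phi> -` U m j)"
    unfolding U(2) by auto
  ultimately show False
    by simp
qed

end
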